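(* Let $G$ be a finite group, let $\lambda$ be a positive integer, let $s,t$ be nonnegative integers with $|G|=s+t+1$, and let $S\subseteq G$. Then there exists $T\subseteq G$ such that $(S,T)$ is an $(s,t)$-$\lambda$-fold near-factorization of $G$ if and only if $S$ is translate-equivalent to an $(s+t+1,s,s-\lambda-1,s-\lambda)$-partial difference set in $G$. Moreover, any such near-factorization $(S,T)$ is necessarily translate-equivalent to a symmetric near-factorization.
   Context: Subsets of $G$ are identified with the sums of their elements in the group ring $\mathbb{Z}[G]$; $e$ is the identity of $G$; for a subset $D$, $D^{(-1)}=\{d^{-1}:d\in D\}$. A $(v,k,\alpha,\mu)$-partial difference set in a group $G$ of order $v$ is a subset $D\subseteq G\setminus\{e\}$ with $|D|=k$ and $DD^{(-1)}=(k-\mu)\cdot e+(\alpha-\mu)D+\mu G$ in $\mathbb{Z}[G]$. For $S,T\subseteq G$ and a positive integer $\lambda$, $(S,T)$ is an $(s,t)$-$\lambda$-fold near-factorization of $G$ if $|S|=s$, $|T|=t$ and $ST=\lambda(G-e)$ in $\mathbb{Z}[G]$. It is symmetric if $S=S^{(-1)}$ and $T=T^{(-1)}$. A subset $B\subseteq G$ is translate-equivalent to $A\subseteq G$ if there is $g\in G$ with $B=gA$ or $B=Ag$. A near-factorization $(S,T)$ is translate-equivalent to a near-factorization $(S',T')$ of the same group (with the same parameters) if there is $g\in G$ with $S'=Sg$ and $T'=g^{-1}T$. *)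

theory Defs
  imports "HOL-Algebra.Ring" "HOL-Algebra.Free_Abelian_Groups"
begin

(* The integral group ring Z[G]: the free abelian group on carrier G, with the
   product of G extended bilinearly. *)
definition group_ring_mult ::
    "('a, 'b) monoid_scheme \<Rightarrow> ('a \<Rightarrow>\<^sub>0 int) \<Rightarrow> ('a \<Rightarrow>\<^sub>0 int) \<Rightarrow> ('a \<Rightarrow>\<^sub>0 int)" where
  "group_ring_mult G a b =
     frag_extend (\<lambda>x. frag_extend (\<lambda>y. frag_of (x \<otimes>\<^bsub>G\<^esub> y)) b) a"

definition group_ring :: "('a, 'b) monoid_scheme \<Rightarrow> ('a \<Rightarrow>\<^sub>0 int) ring" where
  "group_ring G = \<lparr>carrier = {c. Poly_Mapping.keys c \<subseteq> carrier G},
     monoid.mult = group_ring_mult G, one = frag_of \<one>\<^bsub>G\<^esub>, ring.zero = 0, ring.add = (+)\<rparr>"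

(* A subset of G as an element of Z[G]; meant for finite sets (0 on infinite ones). *)
definition subset_sum :: "'a set \<Rightarrow> ('a \<Rightarrow>\<^sub>0 int)" where
  "subset_sum A = (\<Sum>x\<in>A. frag_of x)"

(* The last two parameters are integers since expressions such as s - l - 1,
   which may be negative, are substituted for them. *)
definition partial_difference_set ::
    "('a, 'b) monoid_scheme \<Rightarrow> nat \<Rightarrow> nat \<Rightarrow> int \<Rightarrow> int \<Rightarrow> 'a set \<Rightarrow> bool" where
  "partial_difference_set G v k \<alpha> \<mu> D \<longleftrightarrow>
     order G = v \<and> D \<subseteq> carrier G - {\<one>\<^bsub>G\<^esub>} \<and> card D = k \<and>
     subset_sum D \<otimes>\<^bsub>group_ring G\<^esub> subset_sum (set_inv\<^bsub>G\<^esub> D) =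
       frag_cmul (int k - \<mu>) (frag_of \<one>\<^bsub>G\<^esub>) + frag_cmul (\<alpha> - \<mu>) (subset_sum D)
         + frag_cmul \<mu> (subset_sum (carrier G))"

definition near_factorization ::
    "('a, 'b) monoid_scheme \<Rightarrow> nat \<Rightarrow> nat \<Rightarrow> nat \<Rightarrow> 'a set \<Rightarrow> 'a set \<Rightarrow> bool" where
  "near_factorization G s t l S T \<longleftrightarrow>
     S \<subseteq> carrier G \<and> T \<subseteq> carrier G \<and> 0 < l \<and> card S = s \<and> card T = t \<and>
     subset_sum S \<otimes>\<^bsub>group_ring G\<^esub> subset_sum T =
       frag_cmul (int l) (subset_sum (carrier G) - frag_of \<one>\<^bsub>G\<^esub>)"

definition symmetric_near_factorization ::
    "('a, 'b) monoid_scheme \<Rightarrow> nat \<Rightarrow> nat \<Rightarrow> nat \<Rightarrow> 'a set \<Rightarrow> 'a set \<Rightarrow> bool" where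
  "symmetric_near_factorization G s t l S T \<longleftrightarrow>
     near_factorization G s t l S T \<and> S = set_inv\<^bsub>G\<^esub> S \<and> T = set_inv\<^bsub>G\<^esub> T"

definition translate_equivalent :: "('a, 'b) monoid_scheme \<Rightarrow> 'a set \<Rightarrow> 'a set \<Rightarrow> bool" where
  "translate_equivalent G B A \<longleftrightarrow>
     (\<exists>g\<in>carrier G. B = g <#\<^bsub>G\<^esub> A \<or> B = A #>\<^bsub>G\<^esub> g)"

definition translate_equivalent_pair ::
    "('a, 'b) monoid_scheme \<Rightarrow> 'a set \<times> 'a set \<Rightarrow> 'a set \<times> 'a set \<Rightarrow> bool" where
  "translate_equivalent_pair G = (\<lambda>(S, T) (S', T').
     \<exists>g\<in>carrier G. S' = S #>\<^bsub>G\<^esub> g \<and> T' = inv\<^bsub>G\<^esub> g <#\<^bsub>G\<^esub> T)"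

lemma group_ring_simps [simp]:
  "c \<in> carrier (group_ring G) \<longleftrightarrow> Poly_Mapping.keys c \<subseteq> carrier G"
  "a \<otimes>\<^bsub>group_ring G\<^esub> b = group_ring_mult G a b"
  "\<one>\<^bsub>group_ring G\<^esub> = frag_of \<one>\<^bsub>G\<^esub>"
  "\<zero>\<^bsub>group_ring G\<^esub> = 0"
  "a \<oplus>\<^bsub>group_ring G\<^esub> b = a + b"
  by (simp_all add: group_ring_def)

lemma frag_extend_fun_diff:
  "frag_extend (\<lambda>x. f x - g x) a = frag_extend f a - frag_extend g a"
  by (rule poly_mapping_eqI)
     (simp add: frag_extend_def lookup_sum lookup_minus right_diff_distrib sum_subtractf)

lemma frag_extend_fun_0: "frag_extend (\<lambda>x. 0) a = 0"
  by (simp add: frag_extend_def)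

lemma group_ring_mult_simps [simp]:
  "group_ring_mult G (frag_of x) (frag_of y) = frag_of (x \<otimes>\<^bsub>G\<^esub> y)"
  "group_ring_mult G 0 b = 0" "group_ring_mult G a 0 = 0"
  by (simp_all add: group_ring_mult_def frag_extend_fun_0)

lemma group_ring_mult_diff:
  "group_ring_mult G (a - b) c = group_ring_mult G a c - group_ring_mult G b c"
  "group_ring_mult G a (b - c) = group_ring_mult G a b - group_ring_mult G a c"
  by (simp_all add: group_ring_mult_def frag_extend_diff frag_extend_fun_diff)

lemma group_ring_mult_add:
  "group_ring_mult G (a + b) c = group_ring_mult G a c + group_ring_mult G b c"
  "group_ring_mult G a (b + c) = group_ring_mult G a b + group_ring_mult G a c"
  using group_ring_mult_diff(1)[of G a "- b" c] group_ring_mult_diff(1)[of G 0 b c]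
    group_ring_mult_diff(2)[of G a b "- c"] group_ring_mult_diff(2)[of G a 0 c]
  by simp_all

context group
begin

lemma group_ring_mult_closed:
  assumes "Poly_Mapping.keys a \<subseteq> carrier G" "Poly_Mapping.keys b \<subseteq> carrier G"
  shows "Poly_Mapping.keys (group_ring_mult G a b) \<subseteq> carrier G"
proof -
  have "Poly_Mapping.keys (frag_extend (\<lambda>y. frag_of (x \<otimes> y)) b) \<subseteq> carrier G"
    if "x \<in> carrier G" for x
    using keys_frag_extend[of "\<lambda>y. frag_of (x \<otimes> y)" b] assms that by fastforce
  then show ?thesis
    unfolding group_ring_mult_def using assms(1) by (intro order_trans[OF keys_frag_extend]) blast
qed

lemma group_ring_mult_one:
  assumes "Poly_Mapping.keys a \<subseteq> carrier G"
  shows "group_ring_mult G (frag_of \<one>) a = a" "group_ring_mult G a (frag_of \<one>) = a"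
  using assms by (induction a rule: frag_induction) (auto simp: group_ring_mult_diff)

lemma group_ring_mult_assoc:
  assumes a: "Poly_Mapping.keys a \<subseteq> carrier G" and b: "Poly_Mapping.keys b \<subseteq> carrier G"
    and c: "Poly_Mapping.keys c \<subseteq> carrier G"
  shows "group_ring_mult G (group_ring_mult G a b) c = group_ring_mult G a (group_ring_mult G b c)"
  using a
proof (induction a rule: frag_induction)
  case (one x)
  show ?case using b
  proof (induction b rule: frag_induction)
    case (one y)
    show ?case using c
      by (induction c rule: frag_induction)
         (use \<open>x \<in> carrier G\<close> \<open>y \<in> carrier G\<close> in \<open>auto simp: group_ring_mult_diff m_assoc\<close>)
  qed (auto simp: group_ring_mult_diff)
qed (auto simp: group_ring_mult_diff)

theorem ring_group_ring: "ring (group_ring G)"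
proof (rule ringI)
  show "abelian_group (group_ring G)"
  proof (rule abelian_groupI)
    fix x assume "x \<in> carrier (group_ring G)"
    then show "\<exists>y\<in>carrier (group_ring G). y \<oplus>\<^bsub>group_ring G\<^esub> x = \<zero>\<^bsub>group_ring G\<^esub>"
      by (intro bexI[of _ "- x"]) auto
  qed (use keys_add in \<open>fastforce simp: add_ac\<close>)+
  show "monoid (group_ring G)"
    by (rule monoidI)
       (simp_all add: group_ring_mult_closed group_ring_mult_assoc group_ring_mult_one)
qed (simp_all add: group_ring_mult_add)

end

end

(* Comparing coefficients of the identity in ST = l(G - e) shows that S and the inverse of T are
   disjoint; since |S| + |T| = |G| - 1, exactly one element x lies in neither. Translating by x
   makes x = e, so that T = G - e - D^(-1) with D the translate of S, and then D T = l(G - e) is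
   literally the difference set equation D D^(-1) = l e - D + (s - l) G.  Since D D^(-1) is
   invariant under inversion, so is D, and hence T. *)

theory Submission
  imports Defs
begin

section \<open>Coefficients of subset sums and bilinearity of the product in Z[G]\<close>

lemma lookup_subset_sum:
  assumes "finite A"
  shows "Poly_Mapping.lookup (subset_sum A) x = of_bool (x \<in> A)"
  using assms by (simp add: subset_sum_def lookup_sum lookup_frag_of of_bool_def)

text \<open>The coefficients of a subset sum form the indicator function of the set, so the set can
  be read off. Finiteness excludes infinite sets, whose sum has the default value 0.\<close>

lemma subset_sum_inject:
  assumes "finite A" "finite B"
  shows "subset_sum A = subset_sum B \<longleftrightarrow> A = B"
  using assms lookup_subset_sum by (metis (no_types, lifting) of_bool_eq_iff subset_antisym subset_iff)

lemma keys_subset_sum: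
  assumes "A \<subseteq> B"
  shows "Poly_Mapping.keys (subset_sum A) \<subseteq> B"
  unfolding subset_sum_def by (rule order_trans[OF keys_sum]) (use assms in auto)

lemma subset_sum_singleton [simp]: "subset_sum {x} = frag_of x"
  by (simp add: subset_sum_def)

lemma subset_sum_Diff:
  assumes "finite A" "B \<subseteq> A"
  shows "subset_sum (A - B) = subset_sum A - subset_sum B"
  using assms by (simp add: subset_sum_def sum_diff)

lemma group_ring_mult_sum:
  "group_ring_mult G (\<Sum>x\<in>A. f x) c = (\<Sum>x\<in>A. group_ring_mult G (f x) c)"
  "group_ring_mult G c (\<Sum>x\<in>A. f x) = (\<Sum>x\<in>A. group_ring_mult G c (f x))"
  by (induction A rule: infinite_finite_induct) (simp_all add: group_ring_mult_add)

lemma frag_cmul_right_diff_distrib: "frag_cmul c (a - b) = frag_cmul c a - frag_cmul c b"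
  by (rule poly_mapping_eqI) (simp add: lookup_minus right_diff_distrib)

lemma group_ring_mult_cmul:
  "group_ring_mult G (frag_cmul c a) b = frag_cmul c (group_ring_mult G a b)"
  "group_ring_mult G a (frag_cmul c b) = frag_cmul c (group_ring_mult G a b)"
  by (simp_all add: group_ring_mult_def frag_extend_cmul)
    (simp add: frag_extend_def frag_cmul_sum mult.left_commute)

lemma subset_sum_mult:
  "group_ring_mult G (subset_sum A) (subset_sum B) =
    (\<Sum>x\<in>A. \<Sum>y\<in>B. frag_of (x \<otimes>\<^bsub>G\<^esub> y))"
  unfolding subset_sum_def group_ring_mult_sum(1) by (simp add: group_ring_mult_sum(2))

section \<open>Translates and inverses of subsets as elements of Z[G]\<close>

context group
begin

text \<open>Left translation is injective, so distinct summands stay distinct. This turns statements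
  about cosets into products that associativity can rearrange.\<close>

lemma subset_sum_l_coset:
  assumes "g \<in> carrier G" "A \<subseteq> carrier G"
  shows "subset_sum (g <# A) = group_ring_mult G (frag_of g) (subset_sum A)"
proof -
  have "g <# A = (\<lambda>x. g \<otimes> x) ` A"
    by (auto simp: l_coset_def)
  moreover have "inj_on (\<lambda>x. g \<otimes> x) A"
    using inj_on_cmult[OF assms(1)] assms(2) by (rule inj_on_subset)
  ultimately show ?thesis
    by (simp add: subset_sum_def group_ring_mult_sum sum.reindex)
qed

lemma subset_sum_r_coset:
  assumes "g \<in> carrier G" "A \<subseteq> carrier G"
  shows "subset_sum (A #> g) = group_ring_mult G (subset_sum A) (frag_of g)"
proof -
  have "A #> g = (\<lambda>x. x \<otimes> g) ` A"
    by (auto simp: r_coset_def)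
  moreover have "inj_on (\<lambda>x. x \<otimes> g) A"
    using assms(2,1) by (rule inj_on_g)
  ultimately show ?thesis
    by (simp add: subset_sum_def group_ring_mult_sum sum.reindex)
qed

lemma card_l_coset:
  assumes "g \<in> carrier G" "A \<subseteq> carrier G"
  shows "card (g <# A) = card A"
proof -
  have "g <# A = (\<lambda>x. g \<otimes> x) ` A"
    by (auto simp: l_coset_def)
  then show ?thesis
    using inj_on_subset[OF inj_on_cmult[OF assms(1)] assms(2)] by (simp add: card_image)
qed

lemma card_r_coset:
  assumes "g \<in> carrier G" "A \<subseteq> carrier G"
  shows "card (A #> g) = card A"
proof -
  have "A #> g = (\<lambda>x. x \<otimes> g) ` A"
    by (auto simp: r_coset_def)
  then show ?thesis
    using inj_on_g[OF assms(2,1)] by (simp add: card_image)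
qed

lemma l_coset_carrier: "g \<in> carrier G \<Longrightarrow> g <# carrier G = carrier G"
  by (simp add: coset_join3 subgroup_self)

lemma r_coset_carrier: "g \<in> carrier G \<Longrightarrow> carrier G #> g = carrier G"
  by (simp add: coset_join2 subgroup_self)

lemma set_inv_eq_image: "set_inv A = m_inv G ` A"
  by (auto simp: SET_INV_def)

lemma mem_set_inv_iff:
  assumes "A \<subseteq> carrier G" "x \<in> carrier G"
  shows "x \<in> set_inv A \<longleftrightarrow> inv x \<in> A"
  using assms by (force simp: set_inv_eq_image)

lemma set_inv_closed: "A \<subseteq> carrier G \<Longrightarrow> set_inv A \<subseteq> carrier G"
  by (auto simp: set_inv_eq_image)

lemma card_set_inv:
  assumes "A \<subseteq> carrier G"
  shows "card (set_inv A) = card A"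
  using assms by (simp add: set_inv_eq_image card_image inj_on_subset[OF inv_inj])

lemma set_inv_set_inv:
  assumes "A \<subseteq> carrier G"
  shows "set_inv (set_inv A) = A"
  using assms by (force simp: set_inv_eq_image image_image)

lemma set_inv_carrier: "set_inv (carrier G) = carrier G"
  using set_inv_closed[of "carrier G"] by (force simp: mem_set_inv_iff)

lemma set_inv_Diff:
  assumes "A \<subseteq> carrier G" "B \<subseteq> carrier G"
  shows "set_inv (A - B) = set_inv A - set_inv B"
  unfolding set_inv_eq_image using assms by (intro inj_on_image_set_diff[OF inv_inj]) auto

text \<open>Every left translate x G is G itself, so each x in A contributes one full copy of
  G.\<close>

lemma subset_sum_mult_carrier:
  assumes "A \<subseteq> carrier G"
  shows "group_ring_mult G (subset_sum A) (subset_sum (carrier G)) =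
    frag_cmul (int (card A)) (subset_sum (carrier G))"
proof -
  have "group_ring_mult G (subset_sum A) (subset_sum (carrier G)) =
      (\<Sum>x\<in>A. group_ring_mult G (frag_of x) (subset_sum (carrier G)))"
    by (simp add: subset_sum_def[of A] group_ring_mult_sum)
  also have "\<dots> = (\<Sum>x\<in>A. subset_sum (carrier G))"
    using assms by (intro sum.cong) (auto simp: l_coset_carrier simp flip: subset_sum_l_coset)
  also have "\<dots> = frag_cmul (int (card A)) (subset_sum (carrier G))"
    by (rule poly_mapping_eqI) (simp add: lookup_sum)
  finally show ?thesis .
qed

text \<open>The linear extension of inversion is the standard anti-involution of Z[G]. Since
  inversion is injective, no terms collapse.\<close>

lemma frag_extend_inv_subset_sum:
  assumes "A \<subseteq> carrier G" "finite A"
  shows "frag_extend (\<lambda>x. frag_of (inv x)) (subset_sum A) = subset_sum (set_inv A)"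
  using assms inj_on_subset[OF inv_inj assms(1)]
  by (simp add: subset_sum_def set_inv_eq_image frag_extend_sum sum.reindex o_def)

text \<open>Inversion turns the term x y^(-1) into y x^(-1), so it merely exchanges the two
  summation variables, both of which range over A.\<close>

lemma frag_extend_inv_subset_sum_mult_set_inv:
  assumes "A \<subseteq> carrier G" "finite A"
  shows "frag_extend (\<lambda>x. frag_of (inv x)) (group_ring_mult G (subset_sum A) (subset_sum (set_inv A)))
    = group_ring_mult G (subset_sum A) (subset_sum (set_inv A))"
proof -
  have prod: "group_ring_mult G (subset_sum A) (subset_sum (set_inv A)) =
      (\<Sum>x\<in>A. \<Sum>y\<in>A. frag_of (x \<otimes> inv y))"
    using inj_on_subset[OF inv_inj assms(1)]
    by (simp add: subset_sum_mult set_inv_eq_image sum.reindex)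
  have "frag_extend (\<lambda>x. frag_of (inv x)) (\<Sum>x\<in>A. \<Sum>y\<in>A. frag_of (x \<otimes> inv y)) =
      (\<Sum>x\<in>A. \<Sum>y\<in>A. frag_of (inv (x \<otimes> inv y)))"
    using assms(2) by (simp add: frag_extend_sum o_def)
  also have "\<dots> = (\<Sum>x\<in>A. \<Sum>y\<in>A. frag_of (y \<otimes> inv x))"
    using assms(1) by (intro sum.cong refl) (auto simp: inv_mult_group subset_iff)
  also have "\<dots> = (\<Sum>x\<in>A. \<Sum>y\<in>A. frag_of (x \<otimes> inv y))"
    by (rule sum.swap)
  finally show ?thesis
    by (simp add: prod)
qed

section \<open>Translation of near-factorizations\<close>

text \<open>In (S g)(g^(-1) T) the factors g and g^(-1) meet in the middle and cancel, so the
  product is still S T.\<close>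

lemma near_factorization_translate:
  assumes "near_factorization G s t l S T" "g \<in> carrier G"
  shows "near_factorization G s t l (S #> g) (inv g <# T)"
proof -
  have sub: "S \<subseteq> carrier G" "T \<subseteq> carrier G"
    using assms by (auto simp: near_factorization_def)
  then have keys: "Poly_Mapping.keys (subset_sum S) \<subseteq> carrier G"
      "Poly_Mapping.keys (subset_sum T) \<subseteq> carrier G"
    by (simp_all add: keys_subset_sum)
  have "group_ring_mult G (frag_of g) (group_ring_mult G (frag_of (inv g)) (subset_sum T)) = subset_sum T"
    using keys assms(2) by (simp add: group_ring_mult_one flip: group_ring_mult_assoc)
  then have "group_ring_mult G (group_ring_mult G (subset_sum S) (frag_of g))
      (group_ring_mult G (frag_of (inv g)) (subset_sum T)) =
    group_ring_mult G (subset_sum S) (subset_sum T)"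
    using keys assms(2) by (simp add: group_ring_mult_assoc group_ring_mult_closed)
  then show ?thesis
    using assms sub
    by (simp add: near_factorization_def subset_sum_l_coset subset_sum_r_coset card_l_coset
      card_r_coset l_coset_subset_G r_coset_subset_G)
qed

text \<open>Here the product becomes the conjugate g (S T) g^(-1), and l(G - e) is invariant under
  conjugation. This handles the left translates that \<open>translate_equivalent\<close> also
  admits.\<close>

lemma near_factorization_translate_left:
  assumes "near_factorization G s t l S T" "g \<in> carrier G" "finite (carrier G)"
  shows "near_factorization G s t l (g <# S) (T #> inv g)"
proof -
  have sub: "S \<subseteq> carrier G" "T \<subseteq> carrier G"
    and eq: "group_ring_mult G (subset_sum S) (subset_sum T) =
      frag_cmul (int l) (subset_sum (carrier G) - frag_of \<one>)"
    using assms by (auto simp: near_factorization_def)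
  then have keys: "Poly_Mapping.keys (subset_sum S) \<subseteq> carrier G"
      "Poly_Mapping.keys (subset_sum T) \<subseteq> carrier G"
    by (simp_all add: keys_subset_sum)
  have "group_ring_mult G (group_ring_mult G (frag_of g) (subset_sum S))
      (group_ring_mult G (subset_sum T) (frag_of (inv g))) =
    group_ring_mult G (frag_of g)
      (group_ring_mult G (group_ring_mult G (subset_sum S) (subset_sum T)) (frag_of (inv g)))"
    using keys assms(2) by (simp add: group_ring_mult_assoc group_ring_mult_closed)
  also have "group_ring_mult G (group_ring_mult G (subset_sum S) (subset_sum T)) (frag_of (inv g)) =
      frag_cmul (int l) (subset_sum (carrier G) - frag_of (inv g))"
    using assms(2) by (simp add: eq group_ring_mult_cmul group_ring_mult_diff r_coset_carrier
      flip: subset_sum_r_coset)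
  also have "group_ring_mult G (frag_of g) \<dots> =
      frag_cmul (int l) (subset_sum (carrier G) - frag_of \<one>)"
    using assms(2)
    by (simp add: group_ring_mult_cmul group_ring_mult_diff l_coset_carrier flip: subset_sum_l_coset)
  finally show ?thesis
    using assms sub
    by (simp add: near_factorization_def subset_sum_l_coset subset_sum_r_coset card_l_coset
      card_r_coset l_coset_subset_G r_coset_subset_G)
qed

section \<open>Difference sets and near-factorizations with complementary second factor\<close>

text \<open>With T = G - e - D^(-1), expansion gives D T = s G - D - D D^(-1). Setting this equal to
  l(G - e) and solving for D D^(-1) gives the difference set equation.\<close>

lemma partial_difference_set_iff_near_factorization:
  assumes fin: "finite (carrier G)" and ord: "order G = s + t + 1" and l: "0 < l"
    and D: "D \<subseteq> carrier G - {\<one>}"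
  shows "partial_difference_set G (s + t + 1) s (int s - int l - 1) (int s - int l) D \<longleftrightarrow>
    card D = s \<and> near_factorization G s t l D (carrier G - {\<one>} - set_inv D)"
proof (cases "card D = s")
  case card: True
  have sub: "D \<subseteq> carrier G" "set_inv D \<subseteq> carrier G - {\<one>}"
    using D by (auto simp: set_inv_eq_image)
  \<comment> \<open>\<open>set_inv D\<close> avoids the identity because D does, so 1 + s distinct
    elements are removed from s + t + 1.\<close>
  have card_compl: "card (carrier G - {\<one>} - set_inv D) = t"
    using sub fin ord card by (simp add: card_Diff_subset finite_subset[OF sub(2)] order_def card_set_inv)
  define d where "d = group_ring_mult G (subset_sum D) (subset_sum (set_inv D))"
  have "group_ring_mult G (subset_sum D) (subset_sum (carrier G - {\<one>} - set_inv D)) =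
      frag_cmul (int s) (subset_sum (carrier G)) - subset_sum D - d"
    using fin sub keys_subset_sum[OF sub(1)] card
    by (simp add: subset_sum_Diff group_ring_mult_diff subset_sum_mult_carrier
      group_ring_mult_one d_def)
  \<comment> \<open>The coefficients k - \<mu> = l and \<alpha> - \<mu> = -1 are left unevaluated,
    in the form that unfolding \<open>partial_difference_set_def\<close> produces.\<close>
  moreover have "frag_cmul (int s) (subset_sum (carrier G)) - subset_sum D - d =
      frag_cmul (int l) (subset_sum (carrier G) - frag_of \<one>) \<longleftrightarrow>
    d = frag_cmul (int s - (int s - int l)) (frag_of \<one>)
       + frag_cmul (int s - int l - 1 - (int s - int l)) (subset_sum D)
       + frag_cmul (int s - int l) (subset_sum (carrier G))"
    by (auto simp: frag_cmul_diff_distrib frag_cmul_right_diff_distrib algebra_simps)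
  ultimately show ?thesis
    using D sub card card_compl l ord
    by (auto simp: partial_difference_set_def near_factorization_def d_def)
qed (simp add: partial_difference_set_def)

section \<open>The missing element and the normal form\<close>

text \<open>The coefficient of e in S T counts the pairs (x, y) in S x T with x y = e, and it is 0
  in l(G - e). A common element of S and T^(-1) would supply such a pair.\<close>

lemma near_factorization_disjoint:
  assumes "near_factorization G s t l S T" "finite (carrier G)"
  shows "S \<inter> set_inv T = {}"
proof (rule ccontr)
  assume "S \<inter> set_inv T \<noteq> {}"
  then obtain y where y: "y \<in> T" "inv y \<in> S"
    by (auto simp: set_inv_eq_image)
  have sub: "S \<subseteq> carrier G" "T \<subseteq> carrier G" "finite S" "finite T"
    using assms by (auto simp: near_factorization_def finite_subset)
  have eq: "group_ring_mult G (subset_sum S) (subset_sum T) =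
      frag_cmul (int l) (subset_sum (carrier G) - frag_of \<one>)"
    using assms by (simp add: near_factorization_def)
  have "Poly_Mapping.lookup (group_ring_mult G (subset_sum S) (subset_sum T)) \<one> = 0"
    using assms(2) by (simp add: eq lookup_minus lookup_subset_sum)
  then have "(\<Sum>x\<in>S. \<Sum>y\<in>T. of_bool (\<one> = x \<otimes> y)) = (0 :: int)"
    by (simp add: subset_sum_mult lookup_sum lookup_frag_of of_bool_def)
  then have "\<forall>x\<in>S. \<forall>y\<in>T. \<one> \<noteq> x \<otimes> y"
    using sub by (auto simp: sum_nonneg_eq_0_iff sum_nonneg)
  then have "\<one> \<noteq> inv y \<otimes> y"
    using y by blast
  then show False
    using y sub by auto
qed

text \<open>S and T^(-1) are disjoint and fill s + t of the s + t + 1 elements of G. The single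
  leftover x makes T recoverable from S.\<close>

lemma near_factorization_missing_element:
  assumes nf: "near_factorization G s t l S T" and fin: "finite (carrier G)"
    and ord: "order G = s + t + 1"
  obtains x where "x \<in> carrier G" "x \<notin> S" "T = set_inv (carrier G - {x} - S)"
proof -
  have sub: "S \<subseteq> carrier G" "T \<subseteq> carrier G" and card: "card S = s" "card T = t"
    using nf by (auto simp: near_factorization_def)
  have sub': "S \<union> set_inv T \<subseteq> carrier G"
    using sub set_inv_closed by blast
  have "card (S \<union> set_inv T) = s + t"
    using near_factorization_disjoint[OF nf fin] sub' fin card card_set_inv[OF sub(2)]
    by (subst card_Un_disjoint) (auto intro: finite_subset)
  then have "card (carrier G - (S \<union> set_inv T)) = 1"
    using sub' fin ord by (subst card_Diff_subset) (auto simp: order_def intro: finite_subset)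
  then obtain x where x: "carrier G - (S \<union> set_inv T) = {x}"
    by (auto simp: card_1_singleton_iff)
  have "carrier G - {x} - S = set_inv T"
    using x sub' near_factorization_disjoint[OF nf fin] by blast
  then show thesis
    using that[of x] x set_inv_set_inv[OF sub(2)] by auto
qed

text \<open>The choice is g = x^(-1) with x the missing element, so that x moves to e. As x is not
  in S, the translate of S avoids e; and (x T)^(-1) = T^(-1) x^(-1) carries the complement of S and
  x to the complement of S x^(-1) and e.\<close>

lemma near_factorization_normal_form:
  assumes nf: "near_factorization G s t l S T" and fin: "finite (carrier G)"
    and ord: "order G = s + t + 1"
  obtains g where "g \<in> carrier G" "S #> g \<subseteq> carrier G - {\<one>}"
    "inv g <# T = carrier G - {\<one>} - set_inv (S #> g)"
proof -
  obtain x where x: "x \<in> carrier G" "x \<notin> S" "T = set_inv (carrier G - {x} - S)"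
    using near_factorization_missing_element[OF assms] .
  have S: "S \<subseteq> carrier G" and T: "T \<subseteq> carrier G"
    using nf by (auto simp: near_factorization_def)
  \<comment> \<open>Membership in the two translates is pulled back to S and T, so that the set
    equality can be checked element by element.\<close>
  have mem_S: "y \<in> S #> inv x \<longleftrightarrow> y \<otimes> x \<in> S" if "y \<in> carrier G" for y
  proof
    assume "y \<otimes> x \<in> S"
    then show "y \<in> S #> inv x"
      using x(1) that by (auto simp: r_coset_def m_assoc intro!: bexI[of _ "y \<otimes> x"])
  qed (use x(1) S in \<open>auto simp: r_coset_def m_assoc subset_iff\<close>)
  have mem_T: "y \<in> x <# T \<longleftrightarrow> inv x \<otimes> y \<in> T" if "y \<in> carrier G" for y
  proof
    assume "inv x \<otimes> y \<in> T"
    then show "y \<in> x <# T"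
      using x(1) that by (auto simp: l_coset_def simp flip: m_assoc intro!: bexI[of _ "inv x \<otimes> y"])
  qed (use x(1) T in \<open>auto simp: l_coset_def subset_iff simp flip: m_assoc\<close>)
  have "x <# T = carrier G - {\<one>} - set_inv (S #> inv x)"
  proof (rule Set.set_eqI)
    fix y
    show "y \<in> x <# T \<longleftrightarrow> y \<in> carrier G - {\<one>} - set_inv (S #> inv x)"
    proof (cases "y \<in> carrier G")
      case y: True
      have "inv x \<otimes> y \<in> T \<longleftrightarrow> inv (inv x \<otimes> y) \<in> carrier G - {x} - S"
        unfolding x(3) using x(1) y by (intro mem_set_inv_iff) auto
      then have "y \<in> x <# T \<longleftrightarrow> inv y \<otimes> x \<noteq> x \<and> inv y \<otimes> x \<notin> S"
        using x(1) y by (simp add: mem_T inv_mult_group)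
      \<comment> \<open>By cancellation y^(-1) x = x exactly when y = e; this is where the excluded
        x becomes the excluded identity.\<close>
      also have "\<dots> \<longleftrightarrow> y \<noteq> \<one> \<and> inv y \<notin> S #> inv x"
        using x(1) y by (simp add: mem_S)
      finally show ?thesis
        using y x(1) S by (simp add: mem_set_inv_iff r_coset_subset_G)
    qed (use l_coset_subset_G[OF T x(1)] in blast)
  qed
  moreover have "S #> inv x \<subseteq> carrier G - {\<one>}"
    using mem_S[of \<one>] x S r_coset_subset_G[of S "inv x"] by auto
  ultimately show thesis
    using x(1) by (intro that[of "inv x"]) auto
qed

section \<open>Symmetry of partial difference sets\<close>

text \<open>Applying inversion to the defining equation fixes D D^(-1), e and G, so the only
  remaining term, (\<alpha> - \<mu>) D, must be fixed as well.\<close>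

lemma partial_difference_set_symmetric:
  assumes fin: "finite (carrier G)"
    and pds: "partial_difference_set G v k \<alpha> \<mu> D" and neq: "\<alpha> \<noteq> \<mu>"
  shows "set_inv D = D"
proof -
  define f where "f = frag_extend (\<lambda>x. frag_of (inv x))"
  have D: "D \<subseteq> carrier G" "finite D"
    and eq: "group_ring_mult G (subset_sum D) (subset_sum (set_inv D)) =
      frag_cmul (int k - \<mu>) (frag_of \<one>) + frag_cmul (\<alpha> - \<mu>) (subset_sum D)
        + frag_cmul \<mu> (subset_sum (carrier G))"
    using pds fin by (auto simp: partial_difference_set_def finite_subset)
  have "f (frag_cmul (int k - \<mu>) (frag_of \<one>) + frag_cmul (\<alpha> - \<mu>) (subset_sum D)
        + frag_cmul \<mu> (subset_sum (carrier G))) =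
      frag_cmul (int k - \<mu>) (frag_of \<one>) + frag_cmul (\<alpha> - \<mu>) (subset_sum (set_inv D))
        + frag_cmul \<mu> (subset_sum (carrier G))"
    using D fin
    by (simp add: set_inv_carrier f_def frag_extend_add frag_extend_cmul frag_extend_inv_subset_sum)
  with frag_extend_inv_subset_sum_mult_set_inv[OF D] eq
  have "frag_cmul (\<alpha> - \<mu>) (subset_sum (set_inv D)) = frag_cmul (\<alpha> - \<mu>) (subset_sum D)"
    by (simp add: f_def)
  \<comment> \<open>Passing to integer coefficients allows the nonzero factor \<alpha> - \<mu> to be
    cancelled.\<close>
  then have "(\<alpha> - \<mu>) * Poly_Mapping.lookup (subset_sum (set_inv D)) x =
      (\<alpha> - \<mu>) * Poly_Mapping.lookup (subset_sum D) x" for x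
    by (metis lookup_frag_cmul)
  then have "subset_sum (set_inv D) = subset_sum D"
    using neq by (intro poly_mapping_eqI) simp
  then show ?thesis
    using D by (simp add: subset_sum_inject set_inv_eq_image)
qed

end

section \<open>The equivalence and the symmetric representative\<close>

theorem corollary2p15:
  fixes G :: "('a, 'b) monoid_scheme"
    and S :: "'a set"
    and l s t :: nat
  assumes "group G"
    and "finite (carrier G)"
    and "0 < l"
    and "order G = s + t + 1"
    and "S \<subseteq> carrier G"
  shows "((\<exists>T \<subseteq> carrier G. near_factorization G s t l S T) \<longleftrightarrow>
           (\<exists>D \<subseteq> carrier G.
              partial_difference_set G (s + t + 1) s (int s - int l - 1) (int s - int l) D \<and>
              translate_equivalent G S D)) \<and>
         (\<forall>T \<subseteq> carrier G. near_factorization G s t l S T \<longrightarrow>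
           (\<exists>S' T'. symmetric_near_factorization G s t l S' T' \<and>
              translate_equivalent_pair G (S, T) (S', T')))"
proof -
  interpret group G by fact
  let ?pds = "partial_difference_set G (s + t + 1) s (int s - int l - 1) (int s - int l)"
  note pds_iff = partial_difference_set_iff_near_factorization[OF assms(2,4,3)]
  \<comment> \<open>One translate S g serves both claims: it is the difference set in the
    equivalence and the first factor of the symmetric pair.\<close>
  have pds_translate: "\<exists>g\<in>carrier G. ?pds (S #>\<^bsub>G\<^esub> g) \<and>
      inv\<^bsub>G\<^esub> g <#\<^bsub>G\<^esub> T = carrier G - {\<one>\<^bsub>G\<^esub>} - set_inv\<^bsub>G\<^esub> (S #>\<^bsub>G\<^esub> g)"
    if nf: "near_factorization G s t l S T" for T
  proof -
    obtain g where g: "g \<in> carrier G" "S #>\<^bsub>G\<^esub> g \<subseteq> carrier G - {\<one>\<^bsub>G\<^esub>}"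
        "inv\<^bsub>G\<^esub> g <#\<^bsub>G\<^esub> T = carrier G - {\<one>\<^bsub>G\<^esub>} - set_inv\<^bsub>G\<^esub> (S #>\<^bsub>G\<^esub> g)"
      using near_factorization_normal_form[OF nf assms(2,4)] .
    have "near_factorization G s t l (S #>\<^bsub>G\<^esub> g) (inv\<^bsub>G\<^esub> g <#\<^bsub>G\<^esub> T)"
      using nf g(1) by (rule near_factorization_translate)
    then have "?pds (S #>\<^bsub>G\<^esub> g)"
      using g pds_iff[OF g(2)] by (simp add: near_factorization_def)
    with g show ?thesis
      by blast
  qed
  show ?thesis
  proof (intro conjI iffI allI impI)
    assume "\<exists>T \<subseteq> carrier G. near_factorization G s t l S T"
    then obtain g where g: "g \<in> carrier G" "?pds (S #>\<^bsub>G\<^esub> g)"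
      using pds_translate by blast
    \<comment> \<open>\<open>translate_equivalent\<close> presents S as a translate of D, so the
      shift by g has to be undone.\<close>
    moreover have "S = (S #>\<^bsub>G\<^esub> g) #>\<^bsub>G\<^esub> inv\<^bsub>G\<^esub> g"
      using g(1) assms(5) by (simp add: coset_mult_assoc)
    moreover have "S #>\<^bsub>G\<^esub> g \<subseteq> carrier G"
      using g(1) assms(5) by (simp add: r_coset_subset_G)
    ultimately show "\<exists>D \<subseteq> carrier G. ?pds D \<and> translate_equivalent G S D"
      unfolding translate_equivalent_def by (meson inv_closed)
  next
    assume "\<exists>D \<subseteq> carrier G. ?pds D \<and> translate_equivalent G S D"
    then obtain D g where D: "?pds D" "g \<in> carrier G" "S = g <#\<^bsub>G\<^esub> D \<or> S = D #>\<^bsub>G\<^esub> g"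
      by (auto simp: translate_equivalent_def)
    define T where "T = carrier G - {\<one>\<^bsub>G\<^esub>} - set_inv\<^bsub>G\<^esub> D"
    have "near_factorization G s t l D T"
      using D(1) pds_iff[of D] by (simp add: T_def partial_difference_set_def)
    \<comment> \<open>If S = g D, the second factor is compensated to T g^(-1); if S = D g, it is
      compensated to g^(-1) T.\<close>
    then have "near_factorization G s t l S (T #>\<^bsub>G\<^esub> inv\<^bsub>G\<^esub> g) \<or>
      near_factorization G s t l S (inv\<^bsub>G\<^esub> g <#\<^bsub>G\<^esub> T)"
      using D near_factorization_translate near_factorization_translate_left assms(2) by blast
    then show "\<exists>T \<subseteq> carrier G. near_factorization G s t l S T"
      by (auto simp: near_factorization_def)
  next
    fix T assume nf: "near_factorization G s t l S T"
    then obtain g where g: "g \<in> carrier G" "?pds (S #>\<^bsub>G\<^esub> g)"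
        "inv\<^bsub>G\<^esub> g <#\<^bsub>G\<^esub> T = carrier G - {\<one>\<^bsub>G\<^esub>} - set_inv\<^bsub>G\<^esub> (S #>\<^bsub>G\<^esub> g)"
      using pds_translate by blast
    \<comment> \<open>The parameters satisfy \<alpha> - \<mu> = -1, so they are distinct as the
      symmetry argument requires.\<close>
    have symS: "set_inv\<^bsub>G\<^esub> (S #>\<^bsub>G\<^esub> g) = S #>\<^bsub>G\<^esub> g"
      using partial_difference_set_symmetric[OF assms(2) g(2)] by simp
    have sub: "S #>\<^bsub>G\<^esub> g \<subseteq> carrier G"
      using g(1) assms(5) by (simp add: r_coset_subset_G)
    have "set_inv\<^bsub>G\<^esub> (inv\<^bsub>G\<^esub> g <#\<^bsub>G\<^esub> T) = inv\<^bsub>G\<^esub> g <#\<^bsub>G\<^esub> T"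
    proof -
      \<comment> \<open>By \<open>symS\<close> the second factor is the complement of e and S g, and
        G, e and S g are each stable under inversion.\<close>
      have "set_inv\<^bsub>G\<^esub> (carrier G - {\<one>\<^bsub>G\<^esub>} - (S #>\<^bsub>G\<^esub> g)) =
          carrier G - {\<one>\<^bsub>G\<^esub>} - (S #>\<^bsub>G\<^esub> g)"
        using sub
        by (subst set_inv_Diff; force simp: set_inv_Diff set_inv_carrier symS set_inv_eq_image[of "{_}"])
      then show ?thesis
        by (simp add: g(3) symS)
    qed
    then show "\<exists>S' T'. symmetric_near_factorization G s t l S' T' \<and>
        translate_equivalent_pair G (S, T) (S', T')"
      using near_factorization_translate[OF nf g(1)] g(1) symS
      by (force simp: symmetric_near_factorization_def translate_equivalent_pair_def)
  qed
qed

end
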